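(* Consider the transposition game on an infinite domain $D\subset\mathbb{Z}$, identified up to order isomorphism with one of $\mathbb{Z}$, $\mathbb{Z}_+$, $\mathbb{Z}_-$, with an initial sequence of $m$ distinct elements of $D$ and $n$ turns to be played ($n$ a positive integer). Pivots and the end $S$-block refer to the set $S$ of elements of the initial sequence. - If there is exactly one pivot, then the first player wins. - If there is more than one pivot, then Black wins. - If there is no pivot and - $D=\mathbb{Z}$, then the second player wins; - $D=\mathbb{Z}_+$, then the player who wants the parity of the final sequence to be the initial parity wins; - $D=\mathbb{Z}_-$, then the parity of the final sequence is determined as a function of $n$, the initial parity and the number $\ell$ of terms in the end $S$-block: if $n$ is even, the final parity is the initial one plus $n/2$ (modulo 2); if $n$ is odd, the final parity is the initial one plus $\ell+(n-1)/2$ (modulo 2).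
   Context: Transposition game: given a domain $D\subset\mathbb{R}$, a finite sequence of $m$ distinct elements of $D$, and a positive integer $n$, with at least $m+n$ elements in $D$. Two players alternate; at each turn the player to move appends to the sequence one element of $D$ not already in it. After $n$ turns the sequence has $m+n$ terms and the game ends. One player wants the parity of the final sequence to be even, the other wants it to be odd (which player has which goal is fixed before the game starts). The parity of a finite sequence of distinct reals is the parity (mod 2) of the number of transpositions needed to put it in order; the initial parity is the parity of the initial sequence. Black is the player who plays the last turn, and White is the player who plays the second last turn; so if $n$ is odd Black is the first player, and if $n$ is even White is the first player. The second player is the opponent of the first player. "A player wins" means that this player has a winning strategy. $S$ denotes the set of elements already in the sequence; elements of $D\setminus S$ are called free. For $a,b\in S$, write $a\sim_S b$ if $[a,b]\cap D\subset S$, where $[a,b]$ is the closed interval with endpoints $a$ and $b$; this is an equivalence relation and its classes are the $S$-blocks. A pivot is an $S$-block with an odd number of elements such that there exist two free elements, one of which is smaller and the other larger than the elements of the block. The end $S$-block is the $S$-block containing the last (largest) term of $D$; if there is no such block (in particular if $D$ has no last term), the end $S$-block is said to be empty and its number of terms is $0$. Every infinite subset of $\mathbb{Z}$ is order isomorphic to one of $\mathbb{Z}$, $\mathbb{Z}_+$ (the nonnegative integers), $\mathbb{Z}_-$ (the nonpositive integers), so there is no loss of generality in assuming that $D$ is one of these three sets.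
   Formalization: In the case of no pivot and D = Z, the claim that the second player wins is proved for n at least 2; for n = 1 it is false, since the single move always leaves the initial parity, so a first player who wants that parity wins. *)

theory Defs
  imports Main "HOL-Combinatorics.Permutations" "HOL-Library.Z2"
begin

text \<open>The game is defined over an arbitrary linear order \<open>'a\<close>, which covers domains of reals as
  well as domains of integers. Parities are elements of the two-element field \<^typ>\<open>bit\<close>.\<close>

definition sorting_perm :: "'a::linorder list \<Rightarrow> nat \<Rightarrow> nat" where
  "sorting_perm xs = (THE p. p permutes {..<length xs} \<and> sorted (permute_list p xs))"

text \<open>\<^const>\<open>evenperm\<close> is the parity of the number of transpositions in a decomposition. Only
  sequences of distinct elements are considered; for them the sorting permutation is unique.\<close>

definition seq_parity :: "'a::linorder list \<Rightarrow> bit" where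
  "seq_parity xs = (if evenperm (sorting_perm xs) then 0 else 1)"

datatype player = First | Second

text \<open>Turns are numbered from 0.\<close>

definition mover :: "nat \<Rightarrow> player" where
  "mover k = (if even k then First else Second)"

definition black :: "nat \<Rightarrow> player" where
  "black n = mover (n - 1)"

text \<open>\<open>s\<close> is the initial sequence and \<open>ms\<close> the list of terms appended so far.\<close>

definition legal_play :: "'a set \<Rightarrow> 'a list \<Rightarrow> 'a list \<Rightarrow> bool" where
  "legal_play D s ms \<longleftrightarrow> set ms \<subseteq> D \<and> distinct (s @ ms)"

text \<open>A strategy \<open>\<sigma>\<close> maps the current sequence to the next term. As the current sequence extends
  the initial one, it records the whole history of the game.\<close>

definition follows :: "'a list \<Rightarrow> player \<Rightarrow> ('a list \<Rightarrow> 'a) \<Rightarrow> 'a list \<Rightarrow> bool" where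
  "follows s p \<sigma> ms \<longleftrightarrow> (\<forall>k<length ms. mover k = p \<longrightarrow> ms ! k = \<sigma> (s @ take k ms))"

definition winning_strategy ::
  "'a::linorder set \<Rightarrow> 'a list \<Rightarrow> nat \<Rightarrow> (player \<Rightarrow> bit) \<Rightarrow> player \<Rightarrow> ('a list \<Rightarrow> 'a) \<Rightarrow> bool" where
  "winning_strategy D s n goal p \<sigma> \<longleftrightarrow>
     (\<forall>ms. legal_play D s ms \<and> follows s p \<sigma> ms \<and> length ms < n \<and> mover (length ms) = p
        \<longrightarrow> \<sigma> (s @ ms) \<in> D - set (s @ ms)) \<and>
     (\<forall>ms. legal_play D s ms \<and> follows s p \<sigma> ms \<and> length ms = n
        \<longrightarrow> seq_parity (s @ ms) = goal p)"

definition wins ::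
  "'a::linorder set \<Rightarrow> 'a list \<Rightarrow> nat \<Rightarrow> (player \<Rightarrow> bit) \<Rightarrow> player \<Rightarrow> bool" where
  "wins D s n goal p \<longleftrightarrow> (\<exists>\<sigma>. winning_strategy D s n goal p \<sigma>)"

definition block_rel :: "'a::linorder set \<Rightarrow> 'a set \<Rightarrow> ('a \<times> 'a) set" where
  "block_rel D S = {(a, b). a \<in> S \<and> b \<in> S \<and> {min a b..max a b} \<inter> D \<subseteq> S}"

definition blocks :: "'a::linorder set \<Rightarrow> 'a set \<Rightarrow> 'a set set" where
  "blocks D S = S // block_rel D S"

definition pivots :: "'a::linorder set \<Rightarrow> 'a set \<Rightarrow> 'a set set" where
  "pivots D S = {B \<in> blocks D S. odd (card B) \<and>
     (\<exists>x \<in> D - S. \<exists>y \<in> D - S. \<forall>b \<in> B. x < b \<and> b < y)}"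

text \<open>At most one block contains the last term of \<open>D\<close>; the union is empty if there is none.\<close>

definition end_block :: "'a::linorder set \<Rightarrow> 'a set \<Rightarrow> 'a set" where
  "end_block D S = \<Union> {B \<in> blocks D S. \<exists>t \<in> B. t \<in> D \<and> (\<forall>d \<in> D. d \<le> t)}"

definition order_isomorphic :: "'a::linorder set \<Rightarrow> 'b::linorder set \<Rightarrow> bool" where
  "order_isomorphic A B \<longleftrightarrow> (\<exists>f. bij_betw f A B \<and> strict_mono_on A f)"

end

theory Submission imports Defs begin

text \<open>Attach to every free element \<open>x\<close> the parity of the number of elements of \<open>S\<close> above \<open>x\<close>.
  Appending \<open>w\<close> changes the parity of the sequence by the label of \<open>w\<close>, removes \<open>w\<close> from the free
  elements and flips the labels of all free elements below \<open>w\<close>. The pivots are the places where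
  the label changes between consecutive free elements.

  With exactly one change, the first player may append either of the two free elements next to it:
  both make all labels equal, and the two resulting parities differ. With equal labels, only the
  least or greatest free element (if it exists) can be appended without creating exactly one
  change, so whoever does something else is answered by the previous rule; if the free elements are
  unbounded on both sides the second player wins in this way. With at least two changes, Black can
  append an element far away, keeping two changes, whereas White always leaves at least one.\<close>

subsection \<open>Parity of sequences\<close>

definition odd_above :: "'a::linorder set \<Rightarrow> 'a \<Rightarrow> bool" where
  "odd_above S x \<longleftrightarrow> odd (card {y \<in> S. x < y})"

definition odd_seq :: "'a::linorder list \<Rightarrow> bool" where
  "odd_seq xs \<longleftrightarrow> \<not> evenperm (sorting_perm xs)"

lemma seq_parity_eq: "seq_parity xs = (if odd_seq xs then 1 else 0)"
  by (simp add: seq_parity_def odd_seq_def)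

text \<open>Sorted arrangements of the same distinct list coincide, and distinctness recovers each
  index from its entry, so the \<open>THE\<close> has a unique witness.\<close>

lemma sorting_perm_eqI:
  assumes "distinct xs" "p permutes {..<length xs}" "sorted (permute_list p xs)"
  shows "sorting_perm xs = p"
  unfolding sorting_perm_def
proof (rule the_equality)
  fix q
  assume q: "q permutes {..<length xs} \<and> sorted (permute_list q xs)"
  have eq: "permute_list q xs = permute_list p xs"
    using assms q by (intro sorted_distinct_set_unique) auto
  show "q = p"
  proof
    fix i
    show "q i = p i"
    proof (cases "i < length xs")
      case True
      then have "xs ! q i = xs ! p i"
        using eq assms(2) q by (metis permute_list_nth)
      moreover have "q i < length xs" "p i < length xs"
        using True assms(2) q permutes_in_image[of _ "{..<length xs}" i] by auto
      ultimately show ?thesis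
        using assms(1) nth_eq_iff_index_eq by blast
    next
      case False
      then show ?thesis
        using assms(2) q by (simp add: permutes_def)
    qed
  qed
qed (use assms in auto)

text \<open>Exchanging \<open>x\<close> with its left neighbour, once per element of
  \<open>vs\<close>, is a chain of adjacent transpositions, each flipping the sign. The last element
  of \<open>vs\<close> is passed first, hence the induction from the right.\<close>

lemma permute_list_move_left:
  assumes "q permutes {..<length l}" "permute_list q l = us @ vs @ x # ws"
  shows "\<exists>q'. q' permutes {..<length l} \<and> permute_list q' l = us @ x # vs @ ws \<and>
           (evenperm q' \<longleftrightarrow> (evenperm q \<longleftrightarrow> even (length vs)))"
  using assms
proof (induction vs arbitrary: q ws rule: rev_induct)
  case Nil
  then show ?case by auto
next
  case (snoc v vs)
  \<comment> \<open>\<open>?i\<close> and \<open>Suc ?i\<close> are the positions of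
    \<open>v\<close> and \<open>x\<close>.\<close>
  let ?i = "length us + length vs"
  let ?t = "transpose ?i (Suc ?i)"
  have len: "length l = length us + length vs + 2 + length ws"
    using snoc.prems(2) by (metis length_permute_list length_append length_Cons
        list.size(3) add.assoc add_Suc_right add_Suc numeral_2_eq_2 add_0)
  have t: "?t permutes {..<length l}"
    using len by (intro permutes_swap_id) auto
  then have t': "?t permutes {..<length (permute_list q l)}"
    by simp
  have eq: "permute_list ?t (permute_list q l) = us @ vs @ x # v # ws"
  proof (rule nth_equalityI)
    fix j
    assume "j < length (permute_list ?t (permute_list q l))"
    then show "permute_list ?t (permute_list q l) ! j = (us @ vs @ x # v # ws) ! j"
      by (subst permute_list_nth[OF t'])
        (auto simp: snoc.prems(2) nth_append transpose_def nth_Cons' split: if_splits)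
  qed (use len in auto)
  have comp: "permute_list (q \<circ> ?t) l = us @ vs @ x # v # ws"
    using permute_list_compose[OF t] eq by metis
  have perm: "q \<circ> ?t permutes {..<length l}"
    using t snoc.prems(1) by (rule permutes_compose)
  have "permutation q" "permutation ?t"
    using snoc.prems(1) t permutation_permutes by blast+
  then have ev: "evenperm (q \<circ> ?t) = (\<not> evenperm q)"
    by (simp add: evenperm_comp evenperm_swap)
  obtain q' where q': "q' permutes {..<length l}" "permute_list q' l = us @ x # vs @ v # ws"
    "evenperm q' \<longleftrightarrow> ((\<not> evenperm q) \<longleftrightarrow> even (length vs))"
    using snoc.IH[OF perm comp] unfolding ev by blast
  show ?case
    by (rule exI[of _ q']) (use q' in \<open>cases "evenperm q"; simp\<close>)
qed

text \<open>Sort \<open>s\<close> with \<open>x\<close> left at the end, then move \<open>x\<close>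
  leftwards past the elements exceeding it, whose number has the parity
  \<open>odd_above\<close>.\<close>

lemma odd_seq_snoc:
  assumes "distinct (s @ [x])"
  shows "odd_seq (s @ [x]) \<longleftrightarrow> (odd_seq s \<noteq> odd_above (set s) x)"
proof -
  let ?l = "s @ [x]"
  obtain p where p: "p permutes {..<length s}" "permute_list p s = sort s"
    using mset_eq_permutation[of "sort s" s] by auto
  have sp: "sorting_perm s = p"
    using assms p by (intro sorting_perm_eqI) auto
  have p': "p permutes {..<length ?l}"
    using p(1) by (rule permutes_subset) auto
  have "permute_list p ?l = permute_list p s @ [x]"
  proof (rule nth_equalityI)
    fix i
    assume "i < length (permute_list p ?l)"
    then show "permute_list p ?l ! i = (permute_list p s @ [x]) ! i"
      using p(1) p' permutes_in_image[OF p(1), of i]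
      by (auto simp: permute_list_nth nth_append permutes_def)
  qed auto
  moreover have "sort s = filter (\<lambda>y. y < x) (sort s) @ filter (\<lambda>y. x < y) (sort s)"
    using assms by (intro sorted_distinct_set_unique)
      (auto simp: sorted_append sorted_wrt_filter not_less order.order_iff_strict)
  ultimately have "permute_list p ?l
      = filter (\<lambda>y. y < x) (sort s) @ filter (\<lambda>y. x < y) (sort s) @ x # []"
    using p(2) by (metis append.assoc)
  from permute_list_move_left[OF p' this] obtain q where q: "q permutes {..<length ?l}"
    "permute_list q ?l = filter (\<lambda>y. y < x) (sort s) @ x # filter (\<lambda>y. x < y) (sort s) @ []"
    "evenperm q \<longleftrightarrow> (evenperm p \<longleftrightarrow> even (length (filter (\<lambda>y. x < y) (sort s))))"
    by blast
  have "sorted (permute_list q ?l)"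
    using q(2) by (auto simp: sorted_append sorted_filter[of "\<lambda>x. x", simplified])
  then have "sorting_perm ?l = q"
    using assms q(1) by (intro sorting_perm_eqI) auto
  moreover have "length (filter (\<lambda>y. x < y) (sort s)) = card {y \<in> set s. x < y}"
    using assms by (subst distinct_card[symmetric]) auto
  ultimately show ?thesis
    using q(3) sp by (auto simp: odd_seq_def odd_above_def)
qed

subsection \<open>Winning strategies\<close>

text \<open>\<open>d\<close> records whether the current parity differs from the one we want, and \<open>b\<close> whether we
  are to move.\<close>

primrec forced_win :: "'a::linorder set \<Rightarrow> nat \<Rightarrow> bool \<Rightarrow> 'a set \<Rightarrow> bool \<Rightarrow> bool" where
  "forced_win D 0 b S d \<longleftrightarrow> \<not> d"
| "forced_win D (Suc n) b S d \<longleftrightarrow>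
     (if b then \<exists>x\<in>D - S. forced_win D n False (insert x S) (d \<noteq> odd_above S x)
      else \<forall>x\<in>D - S. forced_win D n True (insert x S) (d \<noteq> odd_above S x))"

text \<open>A strategy that picks some move preserving \<open>forced_win\<close> keeps it invariant
  along the play; after \<open>n\<close> turns the invariant says that the parity is the
  goal.\<close>

lemma forced_win_imp_wins:
  fixes D :: "'a::linorder set"
  assumes "distinct s" and win: "forced_win D n (p = First) (set s) (seq_parity s \<noteq> goal p)"
  shows "wins D s n goal p"
proof -
  \<comment> \<open>A strategy sees only the current sequence \<open>h\<close>;
    \<open>length h - length s\<close> recovers the number of turns already played.\<close>
  define good where "good = (\<lambda>h x. x \<in> D - set h \<and>
    forced_win D (n - Suc (length h - length s)) False (insert x (set h))
      ((seq_parity h \<noteq> goal p) \<noteq> odd_above (set h) x))"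
  define \<sigma> where "\<sigma> = (\<lambda>h. SOME x. good h x)"
  have good: "good (s @ ms) (\<sigma> (s @ ms))"
    if "forced_win D (n - length ms) (mover (length ms) = p) (set (s @ ms))
          (seq_parity (s @ ms) \<noteq> goal p)"
      "length ms < n" "mover (length ms) = p" for ms
  proof -
    have "n - length ms = Suc (n - Suc (length ms))" using that(2) by simp
    with that have "\<exists>x. good (s @ ms) x" by (auto simp: good_def)
    then show ?thesis unfolding \<sigma>_def by (rule someI_ex)
  qed
  have inv: "forced_win D (n - length ms) (mover (length ms) = p) (set (s @ ms))
      (seq_parity (s @ ms) \<noteq> goal p)"
    if "legal_play D s ms" "follows s p \<sigma> ms" "length ms \<le> n" for ms
    using that
  proof (induction ms rule: rev_induct)
    case Nil
    then show ?case using win by (auto simp: mover_def eq_commute[of p])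
  next
    case (snoc x ms)
    have "follows s p \<sigma> ms"
      unfolding follows_def
    proof (intro allI impI)
      fix k
      assume "k < length ms" "mover k = p"
      then show "ms ! k = \<sigma> (s @ take k ms)"
        using snoc.prems(2) unfolding follows_def
        by (metis (no_types, lifting) butlast_snoc length_append_singleton less_SucI
            nth_append take_butlast)
    qed
    moreover have "legal_play D s ms" "x \<in> D - set (s @ ms)" "distinct ((s @ ms) @ [x])"
      using snoc.prems(1) by (auto simp: legal_play_def)
    ultimately have IH: "forced_win D (n - length ms) (mover (length ms) = p) (set (s @ ms))
        (seq_parity (s @ ms) \<noteq> goal p)"
      using snoc by auto
    have d: "(seq_parity ((s @ ms) @ [x]) \<noteq> goal p)
        = ((seq_parity (s @ ms) \<noteq> goal p) \<noteq> odd_above (set (s @ ms)) x)"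
      unfolding seq_parity_eq odd_seq_snoc[OF \<open>distinct ((s @ ms) @ [x])\<close>]
      by (cases "goal p") auto
    have n: "n - length ms = Suc (n - Suc (length ms))" using snoc.prems(3) by simp
    have "forced_win D (n - Suc (length ms)) (mover (Suc (length ms)) = p) (insert x (set (s @ ms)))
        ((seq_parity (s @ ms) \<noteq> goal p) \<noteq> odd_above (set (s @ ms)) x)"
    proof (cases "mover (length ms) = p")
      case True
      have "x = \<sigma> (s @ ms)"
        using snoc.prems(2) True by (auto simp: follows_def dest!: spec[of _ "length ms"])
      moreover have "good (s @ ms) (\<sigma> (s @ ms))"
        using good IH True snoc.prems(3) by auto
      moreover have "mover (Suc (length ms)) \<noteq> p"
        using True by (auto simp: mover_def split: if_splits)
      ultimately show ?thesis by (auto simp: good_def)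
    next
      case False
      then have "mover (Suc (length ms)) = p"
        by (cases p) (auto simp: mover_def split: if_splits)
      with False IH \<open>x \<in> D - set (s @ ms)\<close> show ?thesis
        unfolding n by simp
    qed
    then show ?case using d by simp
  qed
  have "winning_strategy D s n goal p \<sigma>"
    unfolding winning_strategy_def
  proof (intro conjI allI impI)
    fix ms
    assume "legal_play D s ms \<and> follows s p \<sigma> ms \<and> length ms < n \<and> mover (length ms) = p"
    then show "\<sigma> (s @ ms) \<in> D - set (s @ ms)"
      using good[of ms] inv[of ms] by (auto simp: good_def)
  next
    fix ms
    assume "legal_play D s ms \<and> follows s p \<sigma> ms \<and> length ms = n"
    then show "seq_parity (s @ ms) = goal p"
      using inv[of ms] by auto
  qed
  then show ?thesis by (auto simp: wins_def)
qed

subsection \<open>Label changes\<close>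

definition constant_above :: "'a::linorder set \<Rightarrow> 'a set \<Rightarrow> bool \<Rightarrow> bool" where
  "constant_above D S c \<longleftrightarrow> (\<forall>x\<in>D - S. odd_above S x = c)"

definition single_change :: "'a::linorder set \<Rightarrow> 'a set \<Rightarrow> bool \<Rightarrow> 'a \<Rightarrow> 'a \<Rightarrow> bool" where
  "single_change D S c x y \<longleftrightarrow> x \<in> D - S \<and> y \<in> D - S \<and> x < y \<and>
     (\<forall>z\<in>D - S. z \<le> x \<and> odd_above S z = c \<or> y \<le> z \<and> odd_above S z \<noteq> c)"

definition changing :: "'a::linorder set \<Rightarrow> 'a set \<Rightarrow> bool" where
  "changing D S \<longleftrightarrow> (\<exists>x\<in>D - S. \<exists>y\<in>D - S. x < y \<and> odd_above S x \<noteq> odd_above S y)"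

text \<open>Two or more changes, expressed by three witnesses instead of a count, so that the effect
  of a move can be read off the witnesses.\<close>

definition zigzag :: "'a::linorder set \<Rightarrow> 'a set \<Rightarrow> bool" where
  "zigzag D S \<longleftrightarrow> (\<exists>x\<in>D - S. \<exists>y\<in>D - S. \<exists>z\<in>D - S. x < y \<and> y < z \<and>
     odd_above S x \<noteq> odd_above S y \<and> odd_above S y \<noteq> odd_above S z)"

lemma odd_above_insert:
  assumes "finite S" "w \<notin> S"
  shows "odd_above (insert w S) x \<longleftrightarrow> (odd_above S x \<noteq> (x < w))"
proof -
  have "{y \<in> insert w S. x < y} = (if x < w then insert w {y \<in> S. x < y} else {y \<in> S. x < y})"
    by auto
  then show ?thesis
    using assms by (auto simp: odd_above_def)
qed

section \<open>Extreme elements of bounded sets of integers\<close>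

lemma int_bdd_below_least:
  fixes A :: "int set"
  assumes "A \<noteq> {}" "bdd_below A"
  obtains m where "m \<in> A" "\<And>a. a \<in> A \<Longrightarrow> m \<le> a"
proof -
  from assms obtain x l where x: "x \<in> A" "\<And>a. a \<in> A \<Longrightarrow> l \<le> a"
    by (auto simp: bdd_below_def)
  let ?B = "A \<inter> {l..x}"
  have "?B \<noteq> {}" using x by auto
  then have m: "Min ?B \<in> ?B" "Min ?B \<le> x"
    using Min_in[of ?B] by simp_all
  have "Min ?B \<le> a" if "a \<in> A" for a
  proof (cases "a \<le> x")
    case True
    then show ?thesis using that x(2) by (intro Min_le) auto
  next
    case False
    then show ?thesis using m(2) by simp
  qed
  with m(1) show thesis by (intro that[of "Min ?B"]) auto
qed

lemma int_bdd_above_greatest: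
  fixes A :: "int set"
  assumes "A \<noteq> {}" "bdd_above A"
  obtains m where "m \<in> A" "\<And>a. a \<in> A \<Longrightarrow> a \<le> m"
proof -
  have "uminus ` A \<noteq> {}" "bdd_below (uminus ` A)"
    using assms by auto
  then obtain m where m: "m \<in> uminus ` A" "\<And>a. a \<in> uminus ` A \<Longrightarrow> m \<le> a"
    by (rule int_bdd_below_least) blast
  show thesis
  proof (rule that)
    show "- m \<in> A" using m(1) by auto
    show "a \<le> - m" if "a \<in> A" for a using m(2)[of "- a"] that by auto
  qed
qed

section \<open>Locating label changes between neighbouring free elements\<close>

text \<open>\<open>u\<close> is the greatest free element up to \<open>y\<close> with the label of
  \<open>x\<close>, and \<open>v\<close> is the next free element; both exist since bounded sets of
  integers attain their bounds.\<close>

lemma consecutive_change: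
  fixes D :: "int set"
  assumes "x \<in> D - S" "y \<in> D - S" "x < y" "odd_above S x \<noteq> odd_above S y"
  obtains u v where "u \<in> D - S" "v \<in> D - S" "x \<le> u" "u < v" "v \<le> y"
    "odd_above S u = odd_above S x" "odd_above S v \<noteq> odd_above S x"
    "\<And>z. z \<in> D - S \<Longrightarrow> z \<le> u \<or> v \<le> z"
proof -
  let ?A = "{z \<in> D - S. z \<le> y \<and> odd_above S z = odd_above S x}"
  have "x \<in> ?A" using assms by simp
  then have A: "?A \<noteq> {}" "bdd_above ?A" by (blast, auto intro: bdd_aboveI[of _ y])
  obtain u where u: "u \<in> ?A" "\<And>z. z \<in> ?A \<Longrightarrow> z \<le> u"
    by (rule int_bdd_above_greatest[OF A]) blast
  have "u < y" using u(1) assms(4) by (auto simp: order.order_iff_strict)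
  let ?B = "{z \<in> D - S. u < z}"
  have B: "?B \<noteq> {}" "bdd_below ?B"
    using assms(2) \<open>u < y\<close> by (auto intro: bdd_belowI[of _ u])
  obtain v where v: "v \<in> ?B" "\<And>z. z \<in> ?B \<Longrightarrow> v \<le> z"
    by (rule int_bdd_below_least[OF B]) blast
  have "v \<le> y" using v(2)[of y] assms(2) \<open>u < y\<close> by simp
  show thesis
  proof (rule that[of u v])
    show "x \<le> u" using u(2)[of x] assms by simp
    show "odd_above S v \<noteq> odd_above S x" using u(2)[of v] v(1) \<open>v \<le> y\<close> by auto
    show "z \<le> u \<or> v \<le> z" if "z \<in> D - S" for z using v(2)[of z] that by force
  qed (use u(1) v(1) \<open>v \<le> y\<close> in auto)
qed

text \<open>Given a consecutive change at \<open>x\<close>, \<open>y\<close>, a free element with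
  the wrong label for its side would form a zigzag with them.\<close>

lemma single_change_if_changing:
  fixes D :: "int set"
  assumes "changing D S" "\<not> zigzag D S"
  obtains c x y where "single_change D S c x y"
proof -
  from assms(1) obtain a b where ab: "a \<in> D - S" "b \<in> D - S" "a < b"
    "odd_above S a \<noteq> odd_above S b"
    by (auto simp: changing_def)
  obtain x y where xy: "x \<in> D - S" "y \<in> D - S" "a \<le> x" "x < y" "y \<le> b"
    "odd_above S x = odd_above S a" "odd_above S y \<noteq> odd_above S a"
    "\<And>z. z \<in> D - S \<Longrightarrow> z \<le> x \<or> y \<le> z"
    by (rule consecutive_change[OF ab]) blast
  have nz: "\<not> (u \<in> D - S \<and> v \<in> D - S \<and> w \<in> D - S \<and> u < v \<and> v < w \<and>
      odd_above S u \<noteq> odd_above S v \<and> odd_above S v \<noteq> odd_above S w)" for u v w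
    using assms(2) unfolding zigzag_def by blast
  have "z \<le> x \<and> odd_above S z = odd_above S a \<or> y \<le> z \<and> odd_above S z \<noteq> odd_above S a"
    if z: "z \<in> D - S" for z
  proof (cases "z \<le> x")
    case True
    then show ?thesis
      using nz[of z x y] z xy by (cases "z = x") auto
  next
    case False
    then have "y \<le> z" using xy(8)[OF z] by simp
    then show ?thesis
      using nz[of x y z] z xy by (cases "z = y") auto
  qed
  then have "single_change D S (odd_above S a) x y"
    using xy by (auto simp: single_change_def)
  then show thesis by (rule that)
qed

section \<open>How a move acts on label changes\<close>

text \<open>The move flips exactly the labels below \<open>w\<close>, so the only change is at
  \<open>w\<close>; \<open>u\<close> and \<open>v\<close> ensure that free elements remain on both
  sides.\<close>

lemma constant_above_move:
  fixes D :: "int set"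
  assumes "finite S" "constant_above D S c" "w \<in> D - S"
    and "u \<in> D - S" "u < w" "v \<in> D - S" "w < v"
  obtains c' x y where "single_change D (insert w S) c' x y"
proof (rule single_change_if_changing)
  have eq: "odd_above (insert w S) z \<longleftrightarrow> (c \<noteq> (z < w))" if "z \<in> D - insert w S" for z
    using assms that by (auto simp: odd_above_insert constant_above_def)
  show "changing D (insert w S)"
    unfolding changing_def
    by (rule bexI[of _ u], rule bexI[of _ v]) (use eq[of u] eq[of v] assms in auto)
  show "\<not> zigzag D (insert w S)"
  proof
    assume "zigzag D (insert w S)"
    then obtain x y z where "x \<in> D - insert w S" "y \<in> D - insert w S" "z \<in> D - insert w S"
      "x < y" "y < z" "(x < w) \<noteq> (y < w)" "(y < w) \<noteq> (z < w)"
      unfolding zigzag_def using eq by metis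
    then show False by linarith
  qed
qed

text \<open>Among the elements that stay free, either move flips exactly those labelled
  \<open>c\<close>.\<close>

lemma single_change_move:
  assumes "finite S" "single_change D S c x y"
  shows "constant_above D (insert x S) (\<not> c)" "constant_above D (insert y S) (\<not> c)"
proof -
  have xy: "x \<notin> S" "y \<notin> S" "x < y" using assms(2) by (auto simp: single_change_def)
  have dich: "z \<le> x \<and> odd_above S z = c \<or> y \<le> z \<and> odd_above S z \<noteq> c" if "z \<in> D - S" for z
    using assms(2) that unfolding single_change_def by blast
  show "constant_above D (insert x S) (\<not> c)"
    unfolding constant_above_def
  proof
    fix z
    assume "z \<in> D - insert x S"
    then show "odd_above (insert x S) z = (\<not> c)"
      using dich[of z] xy assms(1) by (cases "z < x") (simp_all add: odd_above_insert, force+)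
  qed
  show "constant_above D (insert y S) (\<not> c)"
    unfolding constant_above_def
  proof
    fix z
    assume "z \<in> D - insert y S"
    then show "odd_above (insert y S) z = (\<not> c)"
      using dich[of z] xy assms(1) by (cases "z < y") (simp_all add: odd_above_insert, force+)
  qed
qed

text \<open>Two witnesses on the same side of \<open>w\<close> keep their change, and unless
  \<open>w = y\<close> some adjacent pair of witnesses lies on one side.\<close>

lemma zigzag_move_changing:
  fixes D :: "int set"
  assumes "finite S" "zigzag D S" "w \<in> D - S"
  shows "changing D (insert w S)"
proof -
  from assms(2) obtain x y z where xyz: "x \<in> D - S" "y \<in> D - S" "z \<in> D - S" "x < y" "y < z"
    "odd_above S x \<noteq> odd_above S y" "odd_above S y \<noteq> odd_above S z"
    by (auto simp: zigzag_def)
  note ins = odd_above_insert[of S w]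
  have ch: "changing D (insert w S)"
    if "a \<in> D - S" "b \<in> D - S" "a < b" "a \<noteq> w" "b \<noteq> w"
      "(odd_above S a \<noteq> (a < w)) \<noteq> (odd_above S b \<noteq> (b < w))" for a b
    unfolding changing_def
    by (rule bexI[of _ a], rule bexI[of _ b]) (use that assms ins in auto)
  consider "w \<le> x" | "x < w" "w < y" | "w = y" | "y < w" "w < z" | "z \<le> w"
    by linarith
  then show ?thesis
  proof cases
    case 1
    then show ?thesis using ch[of y z] xyz by auto
  next
    case 2
    then show ?thesis using ch[of y z] xyz by auto
  next
    \<comment> \<open>\<open>x\<close> and \<open>z\<close> have equal labels before the move, which
      flips only that of \<open>x\<close>.\<close>
    case 3
    then show ?thesis using ch[of x z] xyz by auto
  next
    case 4
    then show ?thesis using ch[of x y] xyz by auto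
  next
    case 5
    then show ?thesis using ch[of x y] xyz by auto
  qed
qed

text \<open>Infinitude leaves a free element outside the interval from \<open>x\<close> to
  \<open>z\<close>; appending it flips all three labels or none.\<close>

lemma zigzag_move_zigzag:
  fixes D :: "int set"
  assumes "infinite D" "finite S" "zigzag D S"
  obtains w where "w \<in> D - S" "zigzag D (insert w S)"
proof -
  from assms(3) obtain x y z where xyz: "x \<in> D - S" "y \<in> D - S" "z \<in> D - S" "x < y" "y < z"
    "odd_above S x \<noteq> odd_above S y" "odd_above S y \<noteq> odd_above S z"
    by (auto simp: zigzag_def)
  have "infinite (D - S)" using assms by auto
  then have "\<not> D - S \<subseteq> {x..z}" using finite_subset by blast
  then obtain w where w: "w \<in> D - S" "w < x \<or> z < w" by fastforce
  have "odd_above (insert w S) v \<longleftrightarrow> (odd_above S v \<noteq> (v < w))" for v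
    using w assms(2) by (intro odd_above_insert) auto
  moreover have "(x < w \<longleftrightarrow> y < w) \<and> (y < w \<longleftrightarrow> z < w) \<and> w \<notin> {x, y, z}"
    using w xyz by auto
  ultimately have "zigzag D (insert w S)"
    unfolding zigzag_def using xyz by (intro bexI[of _ x] bexI[of _ y] bexI[of _ z]) simp_all
  with w show thesis using that by blast
qed

subsection \<open>Outcome of the game\<close>

text \<open>\<open>\<tau> c\<close> is a value of \<open>d\<close> that wins when all labels are
  \<open>c\<close> and the opponent is to move. Appending \<open>x\<close> or \<open>y\<close> makes
  all labels \<open>\<not> c\<close> but adds different labels, so one of the two reaches
  \<open>\<tau> (\<not> c)\<close>.\<close>

lemma forced_win_single_change:
  assumes "finite S" "single_change D S c x y"
    and "\<And>S c. finite S \<Longrightarrow> constant_above D S c \<Longrightarrow> forced_win D n False S (\<tau> c)"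
  shows "forced_win D (Suc n) True S d"
proof -
  have x: "x \<in> D - S" "odd_above S x = c" and y: "y \<in> D - S" "odd_above S y \<noteq> c"
    using assms(2) unfolding single_change_def by (metis not_le)+
  have "forced_win D n False (insert x S) (\<tau> (\<not> c))" "forced_win D n False (insert y S) (\<tau> (\<not> c))"
    using single_change_move[OF assms(1,2)] assms(1,3) by auto
  moreover have "\<tau> (\<not> c) = (d \<noteq> odd_above S x) \<or> \<tau> (\<not> c) = (d \<noteq> odd_above S y)"
    using x y by auto
  ultimately have "forced_win D n False (insert x S) (d \<noteq> odd_above S x) \<or>
      forced_win D n False (insert y S) (d \<noteq> odd_above S y)"
    by metis
  then show ?thesis using x(1) y(1) unfolding forced_win.simps(2) by meson
qed

text \<open>For \<open>e = False\<close> the free elements have a least one, and playing it does not affect the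
  others; for \<open>e = True\<close> they have a greatest one, and playing it flips all the others.\<close>

definition has_end :: "int set \<Rightarrow> bool \<Rightarrow> bool" where
  "has_end D e \<longleftrightarrow> infinite D \<and> (if e then bdd_above D else bdd_below D)"

lemma not_bddD:
  fixes F :: "'a::linorder set"
  shows "\<not> bdd_above F \<Longrightarrow> \<exists>v\<in>F. u < v" "\<not> bdd_below F \<Longrightarrow> \<exists>v\<in>F. v < u"
  by (meson bdd_above.I not_le, meson bdd_below.I not_le)

lemma not_bdd_Diff_finite:
  fixes D S :: "int set"
  assumes "finite S"
  shows "\<not> bdd_above D \<Longrightarrow> \<not> bdd_above (D - S)" "\<not> bdd_below D \<Longrightarrow> \<not> bdd_below (D - S)"
proof -
  have "D \<subseteq> (D - S) \<union> S" by auto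
  then show "\<not> bdd_above D \<Longrightarrow> \<not> bdd_above (D - S)" "\<not> bdd_below D \<Longrightarrow> \<not> bdd_below (D - S)"
    using assms bdd_above_mono bdd_below_mono
    by (metis bdd_above_Un bdd_above_finite, metis bdd_below_Un bdd_below_finite)
qed

lemma infinite_int_not_bdd:
  fixes D :: "int set"
  assumes "infinite D"
  shows "bdd_below D \<Longrightarrow> \<not> bdd_above D"
proof
  assume "bdd_below D" "bdd_above D"
  then obtain a b where "\<forall>x\<in>D. a \<le> x" "\<forall>x\<in>D. x \<le> b"
    by (auto simp: bdd_above_def bdd_below_def)
  then have "D \<subseteq> {a..b}" by auto
  with assms show False using finite_subset by blast
qed

text \<open>\<open>w\<close> is the greatest or the least free element, according to
  \<open>e\<close>. The opposite side is unbounded because \<open>D\<close> is infinite, so every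
  other free element is interior.\<close>

lemma has_end_element:
  assumes "has_end D e" "finite S"
  obtains w where "w \<in> D - S" "\<And>z. z \<in> D - S \<Longrightarrow> z < w \<longleftrightarrow> e \<and> z \<noteq> w"
    "\<And>z. z \<in> D - S \<Longrightarrow> z \<noteq> w \<Longrightarrow> \<exists>u\<in>D - S. \<exists>v\<in>D - S. u < z \<and> z < v"
proof -
  let ?F = "D - S"
  have inf: "infinite ?F" using assms by (auto simp: has_end_def)
  then have ne: "?F \<noteq> {}" by (rule infinite_imp_nonempty)
  show thesis
  proof (cases e)
    case False
    have bdd: "bdd_below ?F"
      using assms False bdd_below_mono[of D ?F] by (auto simp: has_end_def)
    obtain w where w: "w \<in> ?F" "\<And>z. z \<in> ?F \<Longrightarrow> w \<le> z"
      by (rule int_bdd_below_least[OF ne bdd]) blast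
    show thesis
    proof (rule that)
      show "z < w \<longleftrightarrow> e \<and> z \<noteq> w" if "z \<in> ?F" for z
        using w(2)[OF that] False by simp
      show "\<exists>u\<in>?F. \<exists>v\<in>?F. u < z \<and> z < v" if z: "z \<in> ?F" "z \<noteq> w" for z
      proof -
        have "w < z" using w(2)[OF z(1)] z(2) by simp
        with w(1) not_bddD(1)[OF infinite_int_not_bdd[OF inf bdd], of z] show ?thesis by blast
      qed
    qed (rule w(1))
  next
    case True
    have bdd: "bdd_above ?F"
      using assms True bdd_above_mono[of D ?F] by (auto simp: has_end_def)
    then have nb: "\<not> bdd_below ?F" using infinite_int_not_bdd[OF inf] by blast
    obtain w where w: "w \<in> ?F" "\<And>z. z \<in> ?F \<Longrightarrow> z \<le> w"
      by (rule int_bdd_above_greatest[OF ne bdd]) blast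
    show thesis
    proof (rule that)
      show "z < w \<longleftrightarrow> e \<and> z \<noteq> w" if "z \<in> ?F" for z
        using w(2)[OF that] True by auto
      show "\<exists>u\<in>?F. \<exists>v\<in>?F. u < z \<and> z < v" if z: "z \<in> ?F" "z \<noteq> w" for z
      proof -
        have "z < w" using w(2)[OF z(1)] z(2) by simp
        with w(1) not_bddD(2)[OF nb, of z] show ?thesis by blast
      qed
    qed (rule w(1))
  qed
qed

text \<open>If all \<open>n\<close> moves are made at the end, the labels appended are \<open>c, c + e, c + 2 e, \<dots>\<close> modulo 2,
  and \<open>n (n - 1) / 2\<close> has the parity of \<open>n div 2\<close>.\<close>

lemma forced_win_constant_end:
  assumes "has_end D e" "finite S" "constant_above D S c"
    and "d = ((odd n \<and> c) \<noteq> (e \<and> odd (n div 2)))"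
  shows "forced_win D n b S d"
  using assms(2-)
proof (induction n arbitrary: b S c d rule: less_induct)
  case (less n)
  show ?case
  proof (cases n)
    case 0
    with less.prems show ?thesis by simp
  next
    case (Suc k)
    obtain w where w: "w \<in> D - S" "\<And>z. z \<in> D - S \<Longrightarrow> z < w \<longleftrightarrow> e \<and> z \<noteq> w"
      "\<And>z. z \<in> D - S \<Longrightarrow> z \<noteq> w \<Longrightarrow> \<exists>u\<in>D - S. \<exists>v\<in>D - S. u < z \<and> z < v"
      using has_end_element[OF assms(1) less.prems(1)] by blast
    have oa: "odd_above S z = c" if "z \<in> D - S" for z
      using less.prems(2) that by (auto simp: constant_above_def)
    have "constant_above D (insert w S) (c \<noteq> e)"
      using less.prems(1) w(1,2) oa by (auto simp: constant_above_def odd_above_insert)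
    \<comment> \<open>The first label \<open>c\<close> is split off; the remaining \<open>k\<close>
      labels start at \<open>c + e\<close>.\<close>
    moreover have "(d \<noteq> c) = ((odd k \<and> (c \<noteq> e)) \<noteq> (e \<and> odd (k div 2)))"
      unfolding less.prems(3) Suc by (cases "even k"; cases "even (k div 2)") (auto elim!: evenE oddE)
    \<comment> \<open>This holds whoever moves next, so the end move serves on our turn and also
      settles one of the opponent's options.\<close>
    ultimately have end_move: "forced_win D k b' (insert w S) (d \<noteq> odd_above S w)" for b'
      using less.IH[of k "insert w S"] less.prems(1) oa[OF w(1)] Suc by auto
    \<comment> \<open>The opponent's other moves are interior. If a turn remains, they create a
      single change for us to exploit; if none remains, they add the same label \<open>c\<close> as
      the end move.\<close>
    have "forced_win D k True (insert z S) (d \<noteq> odd_above S z)" if z: "z \<in> D - S" "z \<noteq> w" for z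
    proof (cases k)
      case 0
      then show ?thesis using less.prems(3) oa[OF z(1)] Suc by simp
    next
      case (Suc j)
      obtain u v where "u \<in> D - S" "v \<in> D - S" "u < z" "z < v" using w(3) z by blast
      then obtain c' x y where "single_change D (insert z S) c' x y"
        using constant_above_move less.prems(1,2) z(1) by metis
      moreover have "forced_win D j False S' ((odd j \<and> c') \<noteq> (e \<and> odd (j div 2)))"
        if "finite S'" "constant_above D S' c'" for S' c'
        using less.IH[OF _ that] \<open>k = Suc j\<close> \<open>n = Suc k\<close> by simp
      ultimately show ?thesis
        unfolding Suc using less.prems(1) by (intro forced_win_single_change) auto
    qed
    then show ?thesis
      using end_move w(1) Suc by (cases b) auto
  qed
qed

text \<open>Every free element is interior, so any opponent move with a turn left after it creates a
  single change to answer. With at most one turn left there is no reply, hence the conditions on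
  \<open>d\<close>.\<close>

lemma forced_win_constant_unbounded:
  fixes D :: "int set"
  assumes "\<not> bdd_below D" "\<not> bdd_above D" "finite S" "constant_above D S c"
    and "n = 0 \<longrightarrow> \<not> d" "n = 1 \<longrightarrow> d = c"
  shows "forced_win D n False S d"
  using assms(3-)
proof (induction n arbitrary: S c d rule: less_induct)
  case (less n)
  show ?case
  proof (cases n)
    case 0
    with less.prems show ?thesis by simp
  next
    case (Suc k)
    have "forced_win D k True (insert z S) (d \<noteq> odd_above S z)" if z: "z \<in> D - S" for z
    proof (cases k)
      case 0
      then show ?thesis using less.prems z Suc by (simp add: constant_above_def)
    next
      case (Suc j)
      obtain u v where "u \<in> D - S" "v \<in> D - S" "u < z" "z < v"
        using not_bddD(1)[OF not_bdd_Diff_finite(1)[OF less.prems(1) assms(2)], of z]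
          not_bddD(2)[OF not_bdd_Diff_finite(2)[OF less.prems(1) assms(1)], of z]
        by blast
      then obtain c' x y where "single_change D (insert z S) c' x y"
        using constant_above_move less.prems(1,2) z(1) by metis
      \<comment> \<open>This value of \<open>d\<close> meets the conditions for every
        \<open>j\<close>: it is \<open>False\<close> for \<open>j = 0\<close> and \<open>c'\<close>
        for \<open>j = 1\<close>; for larger \<open>j\<close> any value would do.\<close>
      moreover have "forced_win D j False S' (j = 1 \<and> c')"
        if "finite S'" "constant_above D S' c'" for S' c'
        using less.IH[OF _ that] \<open>k = Suc j\<close> \<open>n = Suc k\<close> by simp
      ultimately show ?thesis
        unfolding Suc using less.prems(1) by (intro forced_win_single_change) auto
    qed
    then show ?thesis
      using Suc by simp
  qed
qed

text \<open>An infinite set of integers has an end or is unbounded on both sides; each case supplies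
  the function \<open>\<tau>\<close> needed to exploit the single change.\<close>

lemma forced_win_changing:
  fixes D :: "int set"
  assumes "infinite D" "finite S" "changing D S" "\<not> zigzag D S"
  shows "forced_win D (Suc n) True S d"
proof -
  obtain c x y where sc: "single_change D S c x y"
    using single_change_if_changing assms(3,4) by blast
  show ?thesis
  proof (cases "\<exists>e. has_end D e")
    case True
    then obtain e where "has_end D e" by blast
    then show ?thesis
      by (intro forced_win_single_change[OF assms(2) sc]) (rule forced_win_constant_end[OF _ _ _ refl])
  next
    case False
    then have nb: "\<not> bdd_below D" "\<not> bdd_above D"
      using assms(1) has_end_def[of D True] has_end_def[of D False] by auto
    show ?thesis
      by (rule forced_win_single_change[OF assms(2) sc, where \<tau> = "\<lambda>c. n = 1 \<and> c"])
        (rule forced_win_constant_unbounded[OF nb], auto)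
  qed
qed

text \<open>The flag \<open>odd n\<close> says that the last turn is ours. Our earlier moves keep
  the zigzag; an opponent's move leaves a change, and if the zigzag is gone we win by being on move.
  On the last turn both labels are available.\<close>

lemma forced_win_zigzag:
  fixes D :: "int set"
  assumes "infinite D" "finite S" "zigzag D S" "n > 0"
  shows "forced_win D n (odd n) S d"
  using assms(4,2,3)
proof (induction n arbitrary: S d rule: nat_induct_non_zero)
  case (1 S d)
  then obtain x y where "x \<in> D - S" "y \<in> D - S" "odd_above S x \<noteq> odd_above S y"
    unfolding zigzag_def by blast
  then have "\<exists>x\<in>D - S. odd_above S x = d" by (metis (full_types))
  then show ?case by auto
next
  case (Suc n S d)
  show ?case
  proof (cases "even n")
    case True
    obtain w where "w \<in> D - S" "zigzag D (insert w S)"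
      using zigzag_move_zigzag[OF assms(1) Suc.prems] by blast
    with Suc.IH[of "insert w S"] Suc.prems(1) True show ?thesis by auto
  next
    case False
    have "forced_win D n True (insert z S) (d \<noteq> odd_above S z)" if "z \<in> D - S" for z
    proof (cases "zigzag D (insert z S)")
      case True
      with Suc.IH[of "insert z S"] Suc.prems(1) False show ?thesis by auto
    next
      case nz: False
      obtain j where "n = Suc j" using Suc.hyps by (cases n) auto
      with nz show ?thesis
        using forced_win_changing[OF assms(1) _ _ nz] zigzag_move_changing[OF Suc.prems that] Suc.prems(1)
        by auto
    qed
    with False show ?thesis by simp
  qed
qed

subsection \<open>Pivots\<close>

text \<open>The counts above \<open>x\<close> and above \<open>y\<close> differ by the elements in
  between. For neighbouring free elements this ties label changes to odd blocks.\<close>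

lemma odd_above_diff:
  assumes "finite S" "x \<notin> S" "y \<notin> S" "x < y"
  shows "(odd_above S x \<noteq> odd_above S y) \<longleftrightarrow> odd (card {s \<in> S. x < s \<and> s < y})"
proof -
  let ?A = "{s \<in> S. x < s \<and> s < y}" and ?B = "{s \<in> S. y < s}"
  have "{s \<in> S. x < s} = ?A \<union> ?B"
    using assms(3,4) by (auto simp: not_less order.order_iff_strict)
  moreover have "card (?A \<union> ?B) = card ?A + card ?B"
    using assms(1) by (intro card_Un_disjoint) auto
  ultimately have "card {s \<in> S. x < s} = card ?A + card ?B" by simp
  then show ?thesis by (auto simp: odd_above_def)
qed

text \<open>A free element differs from \<open>a\<close> and \<open>b\<close>, so it lies in the
  closed interval exactly if it separates them.\<close>

lemma block_rel_iff:
  assumes "S \<subseteq> D" "a \<in> S"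
  shows "(a, b) \<in> block_rel D S \<longleftrightarrow> b \<in> S \<and> (\<forall>z\<in>D - S. z < a \<longleftrightarrow> z < b)"
proof -
  have "{min a b..max a b} \<inter> D \<subseteq> S \<longleftrightarrow> (\<forall>z\<in>D - S. z < a \<longleftrightarrow> z < b)" if "b \<in> S"
  proof -
    have "z \<in> {min a b..max a b} \<longleftrightarrow> (z < a) \<noteq> (z < b)" if "z \<in> D - S" for z
      using that \<open>a \<in> S\<close> \<open>b \<in> S\<close> by (auto simp: min_def max_def not_less order.order_iff_strict)
    then show ?thesis by blast
  qed
  then show ?thesis using assms by (auto simp: block_rel_def)
qed

lemma blocksE:
  assumes "S \<subseteq> D" "B \<in> blocks D S"
  obtains a where "a \<in> B" "a \<in> S" "B = {b \<in> S. \<forall>z\<in>D - S. z < a \<longleftrightarrow> z < b}"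
proof -
  from assms(2) obtain a where a: "a \<in> S" "B = block_rel D S `` {a}"
    by (auto simp: blocks_def quotient_def)
  then have "B = {b \<in> S. \<forall>z\<in>D - S. z < a \<longleftrightarrow> z < b}"
    using block_rel_iff[OF assms(1) a(1)] by auto
  with a(1) show thesis by (intro that[of a]) auto
qed

lemma blocksI:
  assumes "S \<subseteq> D" "a \<in> S" "B = {b \<in> S. \<forall>z\<in>D - S. z < a \<longleftrightarrow> z < b}"
  shows "B \<in> blocks D S"
proof -
  have "B = block_rel D S `` {a}"
    using block_rel_iff[OF assms(1,2)] assms(3) by auto
  with assms(2) show ?thesis by (auto simp: blocks_def quotient_def)
qed

lemma finite_pivots:
  assumes "finite S" "S \<subseteq> D"
  shows "finite (pivots D S)"
proof (rule finite_subset)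
  show "pivots D S \<subseteq> Pow S"
    by (auto simp: pivots_def elim!: blocksE[OF assms(2)])
qed (use assms in auto)

text \<open>\<open>x\<close> and \<open>y\<close> are the free elements nearest to the block; they
  exist because a pivot has free elements on both sides.\<close>

lemma pivotE:
  fixes D :: "int set"
  assumes "S \<subseteq> D" "finite S" "B \<in> pivots D S"
  obtains x y where "x \<in> D - S" "y \<in> D - S" "x < y" "B = {s \<in> S. x < s \<and> s < y}"
    "odd_above S x \<noteq> odd_above S y" "\<And>z. z \<in> D - S \<Longrightarrow> z \<le> x \<or> y \<le> z"
proof -
  from assms(3) have B: "B \<in> blocks D S" "odd (card B)" by (auto simp: pivots_def)
  from B(1) obtain a where a: "a \<in> B" "a \<in> S" "B = {b \<in> S. \<forall>z\<in>D - S. z < a \<longleftrightarrow> z < b}"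
    by (rule blocksE[OF assms(1)])
  from assms(3) a(1) obtain u v where uv: "u \<in> D - S" "v \<in> D - S" "u < a" "a < v"
    by (auto simp: pivots_def)
  let ?L = "{z \<in> D - S. z < a}" and ?R = "{z \<in> D - S. a < z}"
  have L: "?L \<noteq> {}" "bdd_above ?L" and R: "?R \<noteq> {}" "bdd_below ?R"
    using uv by (auto intro: bdd_aboveI[of _ a] bdd_belowI[of _ a])
  obtain x where x: "x \<in> ?L" "\<And>z. z \<in> ?L \<Longrightarrow> z \<le> x"
    by (rule int_bdd_above_greatest[OF L]) blast
  obtain y where y: "y \<in> ?R" "\<And>z. z \<in> ?R \<Longrightarrow> y \<le> z"
    by (rule int_bdd_below_least[OF R]) blast
  have sep: "z \<le> x \<or> y \<le> z" if "z \<in> D - S" for z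
  proof -
    have "z \<noteq> a" using that a(2) by auto
    then show ?thesis using x(2)[of z] y(2)[of z] that by force
  qed
  have "B = {s \<in> S. x < s \<and> s < y}"
  proof (intro set_eqI iffI)
    fix b
    assume "b \<in> B"
    then have b: "b \<in> S" "\<And>z. z \<in> D - S \<Longrightarrow> z < a \<longleftrightarrow> z < b" using a(3) by auto
    have "x < b" using b(2)[of x] x(1) by auto
    moreover have "\<not> y < b" "y \<noteq> b" using b(1) b(2)[of y] y(1) by auto
    ultimately show "b \<in> {s \<in> S. x < s \<and> s < y}" using b(1) by auto
  next
    fix b
    assume b: "b \<in> {s \<in> S. x < s \<and> s < y}"
    have "z < a \<longleftrightarrow> z < b" if "z \<in> D - S" for z
      using sep[OF that] b x(1) y(1) by auto
    with b a(3) show "b \<in> B" by auto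
  qed
  moreover have "odd_above S x \<noteq> odd_above S y"
    using odd_above_diff[OF assms(2), of x y] x(1) y(1) B(2) calculation by auto
  ultimately show thesis
    using that[of x y] x(1) y(1) sep by auto
qed

text \<open>Between neighbouring free elements with different labels lie an odd number of elements
  of \<open>S\<close>, and these form a block. Its nonemptiness later tells pivots in disjoint
  intervals apart.\<close>

lemma pivot_between:
  fixes D :: "int set"
  assumes "S \<subseteq> D" "finite S" "x \<in> D - S" "y \<in> D - S" "x < y" "odd_above S x \<noteq> odd_above S y"
  obtains B where "B \<in> pivots D S" "B \<noteq> {}" "\<And>b. b \<in> B \<Longrightarrow> x < b \<and> b < y"
proof -
  obtain u v where uv: "u \<in> D - S" "v \<in> D - S" "x \<le> u" "u < v" "v \<le> y"
    "odd_above S u = odd_above S x" "odd_above S v \<noteq> odd_above S x"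
    "\<And>z. z \<in> D - S \<Longrightarrow> z \<le> u \<or> v \<le> z"
    by (rule consecutive_change[OF assms(3-6)]) blast
  let ?P = "{s \<in> S. u < s \<and> s < v}"
  have odd: "odd (card ?P)"
    using odd_above_diff[OF assms(2), of u v] uv by auto
  then obtain a where a: "a \<in> ?P" by (metis card.empty even_zero ex_in_conv)
  have "?P = {b \<in> S. \<forall>z\<in>D - S. z < a \<longleftrightarrow> z < b}"
  proof (intro set_eqI iffI)
    fix b
    assume "b \<in> ?P"
    then show "b \<in> {b \<in> S. \<forall>z\<in>D - S. z < a \<longleftrightarrow> z < b}"
      using uv(8) a by fastforce
  next
    fix b
    assume b: "b \<in> {b \<in> S. \<forall>z\<in>D - S. z < a \<longleftrightarrow> z < b}"
    then have "u < a \<longleftrightarrow> u < b" using b uv(1) by blast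
    then have "u < b" using a by auto
    moreover have va: "v < a \<longleftrightarrow> v < b" using b uv(2) by blast
    have "\<not> v < b" using a unfolding va[symmetric] by simp
    moreover have "v \<noteq> b" using uv(2) b by auto
    ultimately show "b \<in> ?P" using b by (auto simp: order.order_iff_strict)
  qed
  then have "?P \<in> blocks D S" using blocksI[OF assms(1)] a by blast
  then have "?P \<in> pivots D S"
    unfolding pivots_def using odd uv by auto
  then show thesis using a uv by (intro that[of ?P]) auto
qed

lemma changing_iff_pivots_nonempty:
  fixes D :: "int set"
  assumes "S \<subseteq> D" "finite S"
  shows "changing D S \<longleftrightarrow> pivots D S \<noteq> {}"
proof
  assume "changing D S"
  then obtain x y where "x \<in> D - S" "y \<in> D - S" "x < y" "odd_above S x \<noteq> odd_above S y"
    by (auto simp: changing_def)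
  then obtain B where "B \<in> pivots D S" by (rule pivot_between[OF assms])
  then show "pivots D S \<noteq> {}" by blast
next
  assume "pivots D S \<noteq> {}"
  then obtain B where "B \<in> pivots D S" by blast
  then obtain x y where "x \<in> D - S" "y \<in> D - S" "x < y" "odd_above S x \<noteq> odd_above S y"
    by (rule pivotE[OF assms])
  then show "changing D S" unfolding changing_def by blast
qed

text \<open>Two changes give pivots in disjoint intervals. Conversely, distinct pivots are enclosed
  by distinct pairs of neighbouring free elements, which share at most an endpoint, and each pair is
  a change.\<close>

lemma zigzag_iff_pivots:
  fixes D :: "int set"
  assumes "S \<subseteq> D" "finite S"
  shows "zigzag D S \<longleftrightarrow> card (pivots D S) > 1"
proof
  assume "zigzag D S"
  then obtain x y z where xyz: "x \<in> D - S" "y \<in> D - S" "z \<in> D - S" "x < y" "y < z"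
    "odd_above S x \<noteq> odd_above S y" "odd_above S y \<noteq> odd_above S z"
    by (auto simp: zigzag_def)
  obtain B where B: "B \<in> pivots D S" "B \<noteq> {}" "\<And>b. b \<in> B \<Longrightarrow> x < b \<and> b < y"
    by (rule pivot_between[OF assms xyz(1,2,4,6)]) blast
  obtain C where C: "C \<in> pivots D S" "C \<noteq> {}" "\<And>b. b \<in> C \<Longrightarrow> y < b \<and> b < z"
    by (rule pivot_between[OF assms xyz(2,3,5,7)]) blast
  have "B \<noteq> C" using B C by fastforce
  then have "card {B, C} = 2" by simp
  moreover have "card {B, C} \<le> card (pivots D S)"
    using B C finite_pivots[OF assms(2,1)] by (intro card_mono) auto
  ultimately show "card (pivots D S) > 1" by simp
next
  assume "card (pivots D S) > 1"
  then obtain B C where BC: "B \<in> pivots D S" "C \<in> pivots D S" "B \<noteq> C"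
    by (metis card_le_Suc0_iff_eq finite_pivots[OF assms(2,1)] One_nat_def not_le)
  obtain x y where x: "x \<in> D - S" "y \<in> D - S" "x < y" "B = {s \<in> S. x < s \<and> s < y}"
    "odd_above S x \<noteq> odd_above S y" "\<And>z. z \<in> D - S \<Longrightarrow> z \<le> x \<or> y \<le> z"
    by (rule pivotE[OF assms BC(1)]) blast
  obtain u v where u: "u \<in> D - S" "v \<in> D - S" "u < v" "C = {s \<in> S. u < s \<and> s < v}"
    "odd_above S u \<noteq> odd_above S v" "\<And>z. z \<in> D - S \<Longrightarrow> z \<le> u \<or> v \<le> z"
    by (rule pivotE[OF assms BC(2)]) blast
  \<comment> \<open>If \<open>b\<close> and \<open>c\<close> have equal labels, then
    \<open>a\<close>, \<open>b\<close>, \<open>d\<close> alternate; otherwise \<open>a\<close>,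
    \<open>b\<close>, \<open>c\<close> do.\<close>
  have zz: "zigzag D S" if "a \<in> D - S" "b \<in> D - S" "c \<in> D - S" "d \<in> D - S" "a < b" "b \<le> c" "c < d"
    "odd_above S a \<noteq> odd_above S b" "odd_above S c \<noteq> odd_above S d" for a b c d
  proof (cases "odd_above S b = odd_above S c")
    case True
    then show ?thesis
      unfolding zigzag_def using that by (intro bexI[of _ a] bexI[of _ b] bexI[of _ d]) auto
  next
    case False
    then show ?thesis
      unfolding zigzag_def using that
      by (intro bexI[of _ a] bexI[of _ b] bexI[of _ c]) (auto simp: order.order_iff_strict)
  qed
  have "x \<noteq> u \<or> y \<noteq> v" using BC(3) x(4) u(4) by auto
  then have "y \<le> u \<or> v \<le> x"
    using x(3) u(3) x(6)[OF u(1)] x(6)[OF u(2)] u(6)[OF x(1)] u(6)[OF x(2)] by linarith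
  then show "zigzag D S"
    using zz[OF x(1,2) u(1,2) x(3) _ u(3) x(5) u(5)] zz[OF u(1,2) x(1,2) u(3) _ x(3) u(5) x(5)]
    by blast
qed

lemma constant_above_if_no_pivots:
  fixes D :: "int set"
  assumes "S \<subseteq> D" "finite S" "pivots D S = {}" "w \<in> D - S"
  shows "constant_above D S (odd_above S w)"
proof -
  have "\<not> changing D S" using changing_iff_pivots_nonempty[OF assms(1,2)] assms(3) by simp
  then show ?thesis
    unfolding constant_above_def changing_def using assms(4) by (metis linorder_neqE)
qed

text \<open>Only free elements separate blocks, so the block of \<open>t\<close> reaches down to the
  greatest free element \<open>w\<close>. If \<open>t\<close> is free, then \<open>t = w\<close> and
  both sides are empty.\<close>

lemma end_block_eq:
  assumes "S \<subseteq> D" "w \<in> D - S" "\<And>z. z \<in> D - S \<Longrightarrow> z \<le> w"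
    and "t \<in> D" "\<And>d. d \<in> D \<Longrightarrow> d \<le> t"
  shows "end_block D S = {b \<in> S. w < b}"
proof (intro set_eqI iffI)
  fix b
  assume "b \<in> end_block D S"
  then obtain B t' where B: "B \<in> blocks D S" "b \<in> B" "t' \<in> B" "t' \<in> D" "\<forall>d\<in>D. d \<le> t'"
    by (auto simp: end_block_def)
  then have "t' = t" using assms(4,5) by (meson order.antisym)
  obtain a where a: "a \<in> S" "B = {b \<in> S. \<forall>z\<in>D - S. z < a \<longleftrightarrow> z < b}"
    by (rule blocksE[OF assms(1) B(1)])
  have "t' \<in> S" "b \<in> S" "w < t' \<longleftrightarrow> w < b" using B(2,3) a(2) assms(2) by auto
  moreover have "w < t'"
    using B(5) assms(2) \<open>t' \<in> S\<close> by (metis DiffD1 DiffD2 order.order_iff_strict)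
  ultimately show "b \<in> {b \<in> S. w < b}" by simp
next
  fix b
  assume b: "b \<in> {b \<in> S. w < b}"
  then have "t \<notin> D - S" using assms(1,3,5)
    by (metis (no_types, lifting) mem_Collect_eq not_le subsetD order.trans)
  with assms(4) have "t \<in> S" by blast
  let ?B = "{b \<in> S. \<forall>z\<in>D - S. z < t \<longleftrightarrow> z < b}"
  have "b < t \<or> b = t" using assms(1,5) b by (auto simp: order.order_iff_strict)
  then have "z < t \<longleftrightarrow> z < b" if "z \<in> D - S" for z
    using assms(3)[OF that] b by auto
  with b have "b \<in> ?B" by simp
  moreover have "?B \<in> blocks D S" using blocksI[OF assms(1) \<open>t \<in> S\<close>] by blast
  moreover have "t \<in> ?B" using \<open>t \<in> S\<close> by simp
  ultimately show "b \<in> end_block D S"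
    unfolding end_block_def using assms(4,5) by blast
qed

section \<open>Order types of the domain\<close>

lemma order_isomorphicE:
  assumes "order_isomorphic A B"
  obtains f where "f ` A = B" "\<And>x y. x \<in> A \<Longrightarrow> y \<in> A \<Longrightarrow> f x \<le> f y \<longleftrightarrow> x \<le> y"
proof -
  from assms obtain f where f: "bij_betw f A B" "strict_mono_on A f"
    by (auto simp: order_isomorphic_def)
  have "f x \<le> f y \<longleftrightarrow> x \<le> y" if "x \<in> A" "y \<in> A" for x y
    using strict_mono_onD[OF f(2) that] strict_mono_onD[OF f(2) that(2,1)]
    by (cases x y rule: linorder_cases) auto
  with f(1) show thesis by (intro that[of f]) (auto simp: bij_betw_def)
qed

text \<open>Preimages of \<open>f x - 1\<close> and \<open>f x + 1\<close> lie below and above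
  \<open>x\<close>, so \<open>D\<close> has no extreme element, which a bound would provide.\<close>

lemma order_isomorphic_UNIV_not_bdd:
  fixes D :: "int set"
  assumes "order_isomorphic D (UNIV :: int set)"
  shows "\<not> bdd_below D" "\<not> bdd_above D"
proof -
  obtain f :: "int \<Rightarrow> int" where f: "f ` D = UNIV"
    "\<And>x y. x \<in> D \<Longrightarrow> y \<in> D \<Longrightarrow> f x \<le> f y \<longleftrightarrow> x \<le> y"
    using order_isomorphicE[OF assms] by blast
  have down: "\<exists>y\<in>D. y < x" and up: "\<exists>y\<in>D. x < y" if "x \<in> D" for x
  proof -
    obtain y z where "y \<in> D" "f y = f x - 1" "z \<in> D" "f z = f x + 1"
      using f(1) by (metis UNIV_I imageE)
    then show "\<exists>y\<in>D. y < x" "\<exists>y\<in>D. x < y"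
      using f(2)[OF that \<open>y \<in> D\<close>] f(2)[OF \<open>z \<in> D\<close> that] by (auto simp: not_le)
  qed
  have "D \<noteq> {}" using f(1) by blast
  show "\<not> bdd_below D"
  proof
    assume "bdd_below D"
    with \<open>D \<noteq> {}\<close> obtain m where "m \<in> D" "\<And>a. a \<in> D \<Longrightarrow> m \<le> a"
      by (rule int_bdd_below_least) blast
    then show False using down by (meson leD)
  qed
  show "\<not> bdd_above D"
  proof
    assume "bdd_above D"
    with \<open>D \<noteq> {}\<close> obtain m where "m \<in> D" "\<And>a. a \<in> D \<Longrightarrow> a \<le> m"
      by (rule int_bdd_above_greatest) blast
    then show False using up by (meson leD)
  qed
qed

theorem theorem3p1:
  fixes D :: "int set" and s :: "int list" and n :: nat and goal :: "player \<Rightarrow> bit"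
  assumes "infinite D"
    and "distinct s" and "set s \<subseteq> D"
    and "n > 0"
    and "goal First \<noteq> goal Second"
  shows
    "(card (pivots D (set s)) = 1 \<longrightarrow> wins D s n goal First) \<and>
     (card (pivots D (set s)) > 1 \<longrightarrow> wins D s n goal (black n)) \<and>
     (pivots D (set s) = {} \<longrightarrow>
        (order_isomorphic D (UNIV :: int set) \<longrightarrow> n \<ge> 2 \<longrightarrow> wins D s n goal Second) \<and>
        (order_isomorphic D {0::int..} \<longrightarrow>
           (\<forall>p. goal p = seq_parity s \<longrightarrow> wins D s n goal p)) \<and>
        (order_isomorphic D {..0::int} \<longrightarrow>
           (\<forall>p. goal p = (if even n then seq_parity s + of_nat (n div 2)
                          else seq_parity s + of_nat (card (end_block D (set s)))
                               + of_nat ((n - 1) div 2))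
              \<longrightarrow> wins D s n goal p)))"
proof (intro conjI impI allI)
  let ?S = "set s"
  note S = \<open>set s \<subseteq> D\<close> finite_set[of s]
  note wins = forced_win_imp_wins[OF \<open>distinct s\<close>]
  show "wins D s n goal First" if "card (pivots D ?S) = 1"
  proof -
    have "changing D ?S" "\<not> zigzag D ?S"
      using that changing_iff_pivots_nonempty[OF S] zigzag_iff_pivots[OF S] by auto
    from forced_win_changing[OF assms(1) S(2) this, of "n - 1"] \<open>n > 0\<close>
    show ?thesis by (intro wins) simp
  qed
  show "wins D s n goal (black n)" if "card (pivots D ?S) > 1"
  proof -
    \<comment> \<open>Turns are numbered from 0, so the last one is turn \<open>n - 1\<close>; this
      matches the flag in \<open>forced_win_zigzag\<close>.\<close>
    have "(black n = First) = odd n"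
      using \<open>n > 0\<close> by (auto simp: black_def mover_def)
    then show ?thesis
      using forced_win_zigzag[OF assms(1) S(2) _ \<open>n > 0\<close>] that zigzag_iff_pivots[OF S]
      by (intro wins) simp
  qed
  assume np: "pivots D ?S = {}"
  have "infinite (D - ?S)" using assms(1) by simp
  then obtain w where "w \<in> D - ?S" using infinite_imp_nonempty by blast
  then have const: "constant_above D ?S (odd_above ?S w)"
    by (rule constant_above_if_no_pivots[OF S np])
  show "wins D s n goal Second" if "order_isomorphic D (UNIV :: int set)" "n \<ge> 2"
    \<comment> \<open>\<open>n \<ge> 2\<close> makes both conditions on \<open>d\<close>
      vacuous.\<close>
    using that(2) const order_isomorphic_UNIV_not_bdd[OF that(1)]
    by (intro wins) (auto intro!: forced_win_constant_unbounded)
  show "wins D s n goal p" if iso: "order_isomorphic D {0::int..}" and p: "goal p = seq_parity s" for p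
  proof (rule wins)
    obtain f where f: "f ` D = {0::int..}"
      "\<And>x y. x \<in> D \<Longrightarrow> y \<in> D \<Longrightarrow> f x \<le> f y \<longleftrightarrow> x \<le> y"
      using order_isomorphicE[OF iso] by blast
    from f(1) obtain b where b: "b \<in> D" "f b = 0" by (metis atLeast_iff imageE order_refl)
    have "b \<le> d" if "d \<in> D" for d
      using f(1) f(2)[OF b(1) that] b(2) that by auto
    then have bdd: "bdd_below D" by (rule bdd_belowI)
    have "\<not> bdd_above (D - ?S)"
      by (intro not_bdd_Diff_finite(1)[OF S(2)] infinite_int_not_bdd[OF assms(1) bdd])
    \<comment> \<open>A free element beyond all of \<open>S\<close> has label \<open>False\<close>,
      which is then the common label. Inserting 0 keeps \<open>Max\<close> meaningful for empty
      \<open>S\<close>.\<close>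
    from not_bddD(1)[OF this, of "Max (insert 0 ?S)"]
    obtain v where v: "v \<in> D - ?S" "Max (insert 0 ?S) < v" by blast
    have "{y \<in> ?S. v < y} = {}"
      using v(2) by auto
    then have "\<not> odd_above ?S v" by (simp only: odd_above_def card.empty) simp
    then have "constant_above D ?S False"
      using constant_above_if_no_pivots[OF S np v(1)] by simp
    moreover have "has_end D False" using assms(1) bdd by (simp add: has_end_def)
    ultimately show "forced_win D n (p = First) ?S (seq_parity s \<noteq> goal p)"
      using p by (intro forced_win_constant_end[of D False _ False]) auto
  qed
  show "wins D s n goal p" if iso: "order_isomorphic D {..0::int}"
    and p: "goal p = (if even n then seq_parity s + of_nat (n div 2)
                      else seq_parity s + of_nat (card (end_block D ?S)) + of_nat ((n - 1) div 2))" for p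
  proof (rule wins)
    obtain f where f: "f ` D = {..0::int}"
      "\<And>x y. x \<in> D \<Longrightarrow> y \<in> D \<Longrightarrow> f x \<le> f y \<longleftrightarrow> x \<le> y"
      using order_isomorphicE[OF iso] by blast
    from f(1) obtain t where t: "t \<in> D" "f t = 0" by (metis atMost_iff imageE order_refl)
    have max: "d \<le> t" if "d \<in> D" for d
      using f(1) f(2)[OF that t(1)] t(2) that by auto
    then have "bdd_above D" by (rule bdd_aboveI)
    with assms(1) have he: "has_end D True" by (simp add: has_end_def)
    \<comment> \<open>The elements of \<open>S\<close> above the greatest free element
      \<open>v\<close> form the end block, so the common label is the parity of its size.\<close>
    obtain v where v: "v \<in> D - ?S" "\<And>z. z \<in> D - ?S \<Longrightarrow> z < v \<longleftrightarrow> True \<and> z \<noteq> v"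
      by (rule has_end_element[OF he S(2)]) blast
    then have "end_block D ?S = {b \<in> ?S. v < b}"
      using S(1) t(1) max by (intro end_block_eq) (auto simp: order.order_iff_strict)
    then have c: "odd_above ?S v = odd (card (end_block D ?S))"
      by (simp add: odd_above_def)
    have of_nat_bit: "(of_nat k :: bit) = (if odd k then 1 else 0)" for k :: nat
      by (induction k) auto
    have half: "odd n \<Longrightarrow> (n - 1) div 2 = n div 2" by (auto elim!: oddE)
    have "(seq_parity s \<noteq> goal p) = ((odd n \<and> odd_above ?S v) \<noteq> (True \<and> odd (n div 2)))"
      using half unfolding p c of_nat_bit seq_parity_eq by (cases "even n") auto
    then show "forced_win D n (p = First) ?S (seq_parity s \<noteq> goal p)"
      using constant_above_if_no_pivots[OF S np v(1)]
      by (intro forced_win_constant_end[OF he S(2)])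
  qed
qed

end
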